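(* Let $\alpha>0$, $\alpha\ne1$. Consider a $k$-parameter $\mathcal{B}^{(\alpha)}$-family $\{f_\lambda:\lambda\in\Lambda\}$, characterized by $w=[w_1,\dots,w_d]^T$, $h$, $f=[f_1,\dots,f_d]^T$, $\Lambda$ and $S$, with common support $S\subset\mathbb{R}$, and let $\mathcal{L}_{\mathcal{B}}^{(\alpha)}$ be the underlying generalized likelihood function. Suppose that the range of $w(\lambda)$, $\lambda\in\Lambda$, contains a $d$-dimensional rectangle. Then the generalized sufficient statistic $\overline{f}^{d}=[\overline{f_1},\dots,\overline{f_d}]^T$, where $\overline{f_i}=\frac1n\sum_{j=1}^n f_i(Y_j)$, is generalized complete for the $\mathcal{B}^{(\alpha)}$-family.
   Context: $\mathcal{B}^{(\alpha)}$-family: a family $\{f_\lambda:\lambda\in\Lambda\}$ of probability densities, $\Lambda\subseteq\mathbb{R}^k$ open, such that $$f_\lambda(y)=\left[h(y)+Z(\lambda)+w(\lambda)^Tf(y)\right]^{\frac1{\alpha-1}}\ \text{ for }y\in S,\qquad f_\lambda(y)=0\ \text{ otherwise},$$ where $S\subseteq\mathbb{R}$ is the support of $f_\lambda$ (the same for all $\lambda$), $w=[w_1,\dots,w_d]^T$ with each $w_i:\Lambda\to\mathbb{R}$ differentiable, $f=[f_1,\dots,f_d]^T$ with $f_i:\mathbb{R}\to\mathbb{R}$, $h:\mathbb{R}\to\mathbb{R}$, and $Z:\Lambda\to\mathbb{R}$ is the normalizing factor. $Y_1^n=(Y_1,\dots,Y_n)$ is an i.i.d. sample from some $f_\lambda$.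 The generalized likelihood function (associated with the density power divergence) is $$\mathcal{L}_{\mathcal{B}}^{(\alpha)}(y_1^n;\lambda)=\frac1n\sum_{j=1}^n\left[\frac{\alpha f_\lambda^{\alpha-1}(y_j)-1}{\alpha-1}\right]-\int f_\lambda^\alpha(y)\,dy,\qquad y_1^n\in S^n.$$ The deformed distribution is $\widetilde f_\lambda(y_1^n)=\exp[\mathcal{L}_{\mathcal{B}}^{(\alpha)}(y_1^n;\lambda)]\big/\int_{S^n}\exp[\mathcal{L}_{\mathcal{B}}^{(\alpha)}(r_1^n;\lambda)]\,dr_1^n$ on $S^n$, the denominator being assumed finite; $\widetilde P_\lambda,\widetilde E_\lambda$ are probability and expectation under $\widetilde f_\lambda$. A statistic $T$ is generalized sufficient if $\mathcal{L}_{\mathcal{B}}^{(\alpha)}(r_1^n;\lambda)-\mathcal{L}_{\mathcal{B}}^{(\alpha)}(s_1^n;\lambda)$ is independent of $\lambda$ whenever $T(r_1^n)=T(s_1^n)$. It is generalized complete if for every function $\phi$, $\widetilde E_\lambda[\phi(T)]=0$ for all $\lambda\in\Lambda$ implies $\widetilde P_\lambda\{\phi(T)=0\}=1$ for all $\lambda\in\Lambda$. (It is known that $\overline f^d$ is generalized sufficient.) *)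

theory Defs
  imports "HOL-Probability.Probability"
begin

text \<open>
  Dimensions are type-indexed: \<open>\<Lambda> \<subseteq> real ^ 'k\<close>, \<open>w\<close> and \<open>f\<close> take values in \<open>real ^ 'd\<close>, and a
  sample of size \<open>n = CARD('n)\<close> is a vector in \<open>real ^ 'n\<close>. The family is \<open>p\<close>, with \<open>p l\<close> the
  density written \<open>f_\<lambda>\<close> in the literature.

  The support of a density is the set where it is positive. The bracket is required to be
  positive on \<open>S\<close> because \<open>powr\<close> does not have its usual meaning for a negative base.
\<close>

definition B_family ::
  "real \<Rightarrow> (real ^ 'k) set \<Rightarrow> real set \<Rightarrow> (real \<Rightarrow> real) \<Rightarrow> (real ^ 'k \<Rightarrow> real) \<Rightarrow>
   (real ^ 'k \<Rightarrow> real ^ 'd) \<Rightarrow> (real \<Rightarrow> real ^ 'd) \<Rightarrow> (real ^ 'k \<Rightarrow> real \<Rightarrow> real) \<Rightarrow> bool"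
  where
  "B_family \<alpha> \<Lambda> S h Z w f p \<longleftrightarrow>
     open \<Lambda> \<and>
     (\<forall>i. (\<lambda>l. w l $ i) differentiable_on \<Lambda>) \<and>
     (\<forall>l\<in>\<Lambda>.
        p l \<in> borel_measurable borel \<and>
        (\<forall>y. 0 \<le> p l y) \<and>
        prob_space (density lborel (\<lambda>y. ennreal (p l y))) \<and>
        S = {y. 0 < p l y} \<and>
        (\<forall>y\<in>S. 0 < h y + Z l + w l \<bullet> f y \<and>
               p l y = (h y + Z l + w l \<bullet> f y) powr (1 / (\<alpha> - 1))) \<and>
        (\<forall>y. y \<notin> S \<longrightarrow> p l y = 0))"

definition sample_space :: "real set \<Rightarrow> (real ^ 'n) set" where
  "sample_space S = {y. \<forall>j. y $ j \<in> S}"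

definition gen_likelihood ::
  "real \<Rightarrow> ('l \<Rightarrow> real \<Rightarrow> real) \<Rightarrow> real ^ 'n \<Rightarrow> 'l \<Rightarrow> real" where
  "gen_likelihood \<alpha> p y l =
     (1 / real CARD('n)) * (\<Sum>j\<in>UNIV. (\<alpha> * p l (y $ j) powr (\<alpha> - 1) - 1) / (\<alpha> - 1))
     - (\<integral>x. p l x powr \<alpha> \<partial>lborel)"

definition deformed_density ::
  "real \<Rightarrow> real set \<Rightarrow> ('l \<Rightarrow> real \<Rightarrow> real) \<Rightarrow> 'l \<Rightarrow> real ^ 'n \<Rightarrow> real" where
  "deformed_density \<alpha> S p l y =
     exp (gen_likelihood \<alpha> p y l) /
     (LINT r:(sample_space S :: (real ^ 'n) set)|lborel. exp (gen_likelihood \<alpha> p r l))"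

text \<open>
  The deformed distribution lives on \<open>S\<close> to the power \<open>n\<close> (not on the whole of \<open>real ^ 'n\<close>), so values
  of \<open>f\<close> outside the support play no role, not even for measurability.
\<close>

definition deformed_distribution ::
  "real \<Rightarrow> real set \<Rightarrow> ('l \<Rightarrow> real \<Rightarrow> real) \<Rightarrow> 'l \<Rightarrow> (real ^ 'n) measure" where
  "deformed_distribution \<alpha> S p l =
     density (restrict_space lborel (sample_space S)) (\<lambda>y. ennreal (deformed_density \<alpha> S p l y))"

definition mean_statistic :: "(real \<Rightarrow> real ^ 'd) \<Rightarrow> real ^ 'n \<Rightarrow> real ^ 'd" where
  "mean_statistic f y = (\<chi> i. (1 / real CARD('n)) * (\<Sum>j\<in>UNIV. f (y $ j) $ i))"

text \<open>
  Integrability is stated separately because the integral of a non-integrable function is \<open>0\<close>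
  by convention; it includes measurability of \<open>\<phi> \<circ> T\<close>, and \<open>\<phi>\<close> is otherwise arbitrary.
\<close>

definition generalized_complete ::
  "real \<Rightarrow> 'l set \<Rightarrow> real set \<Rightarrow> ('l \<Rightarrow> real \<Rightarrow> real) \<Rightarrow> (real ^ 'n \<Rightarrow> 't) \<Rightarrow> bool" where
  "generalized_complete \<alpha> \<Lambda> S p T \<longleftrightarrow>
     (\<forall>\<phi> :: 't \<Rightarrow> real.
        (\<forall>l\<in>\<Lambda>. integrable (deformed_distribution \<alpha> S p l) (\<lambda>y. \<phi> (T y)) \<and>
               (\<integral>y. \<phi> (T y) \<partial>deformed_distribution \<alpha> S p l) = 0) \<longrightarrow>
        (\<forall>l\<in>\<Lambda>. measure (deformed_distribution \<alpha> S p l)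
                 {y \<in> space (deformed_distribution \<alpha> S p l). \<phi> (T y) = 0} = 1))"

end

theory Submission
  imports Defs "HOL-Complex_Analysis.Cauchy_Integral_Formula"
begin

text \<open>
  On \<open>S\<close> to the power \<open>n\<close> the generalized likelihood has the form
  \<open>L\<^sub>\<lambda> y = H y + K \<lambda> + w \<lambda> \<bullet> T y\<close>, where \<open>T\<close> is the mean statistic times \<open>\<alpha> / (\<alpha> - 1)\<close>, so the
  deformed densities form an ordinary exponential family. With \<open>F = \<phi> exp L\<^sub>\<lambda>\<close> for the \<open>\<lambda>\<close> at the centre
  of the rectangle, the hypothesis says that the integral of \<open>F exp (\<theta> \<bullet> T)\<close> vanishes for all \<open>\<theta>\<close>
  in a cube around \<open>0\<close>. In one dimension, analytic continuation along the imaginary axis turns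
  this into the vanishing of a Fourier transform, and Levy's uniqueness theorem applies. Replacing
  one factor \<open>exp (\<theta>\<^sub>i T\<^sub>i)\<close> after the other by an indicator shows that \<open>F\<close> integrates to \<open>0\<close> over
  every preimage of a Borel set under \<open>T\<close>. Since \<open>\<phi>\<close> need not be Borel, the sets where \<open>\<phi>\<close> is positive
  or negative are then approximated from inside by preimages of compact sets.
\<close>

section \<open>Laplace and Fourier transforms in one variable\<close>

text \<open>Every partial sum of the exponential series is dominated by
  \<open>exp (\<delta> * \<bar>X y\<bar>)\<close>, so dominated convergence permits termwise
  integration. The scalars are generic: the real case yields the moments, the complex case the steps
  along the imaginary axis.\<close>

lemma integral_exp_expansion:
  fixes W :: "'a \<Rightarrow> 'b::{real_normed_field,banach,second_countable_topology}" and X :: "'a \<Rightarrow> real"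
  assumes [measurable]: "W \<in> borel_measurable M" "X \<in> borel_measurable M"
    and int: "integrable M (\<lambda>y. norm (W y) * exp (\<delta> * \<bar>X y\<bar>))"
    and z: "norm z \<le> \<delta>"
  shows "(\<lambda>k. (\<integral>y. W y * of_real (X y ^ k) \<partial>M) / fact k * z ^ k) sums
           (\<integral>y. W y * exp (z * of_real (X y)) \<partial>M)"
proof -
  have bound: "norm (W y * (\<Sum>k<m. (z * of_real (X y)) ^ k / fact k)) \<le> norm (W y) * exp (\<delta> * \<bar>X y\<bar>)" for m y
  proof -
    have "norm (\<Sum>k<m. (z * of_real (X y)) ^ k / fact k)
          \<le> (\<Sum>k<m. norm ((z * of_real (X y)) ^ k / fact k))"
      by (rule norm_sum)
    also have "\<dots> = (\<Sum>k<m. (norm z * \<bar>X y\<bar>) ^ k / fact k)"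
      by (simp add: norm_divide norm_power norm_mult)
    also have "\<dots> \<le> (\<Sum>k. (norm z * \<bar>X y\<bar>) ^ k / fact k)"
      using summable_exp_generic[of "norm z * \<bar>X y\<bar>"]
      by (intro sum_le_suminf) (auto simp: scaleR_conv_of_real field_simps)
    also have "\<dots> = exp (norm z * \<bar>X y\<bar>)"
      by (simp add: exp_def scaleR_conv_of_real field_simps)
    also have "\<dots> \<le> exp (\<delta> * \<bar>X y\<bar>)"
      using z by (simp add: mult_right_mono)
    finally show ?thesis
      by (simp add: norm_mult mult_left_mono)
  qed
  \<comment> \<open>A single term is a difference of two consecutive partial sums, whence twice the
    dominating function.\<close>
  have term_int: "integrable M (\<lambda>y. W y * ((z * of_real (X y)) ^ k / fact k))" for k
  proof (rule Bochner_Integration.integrable_bound[OF Bochner_Integration.integrable_add[OF int int]])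
    show "AE y in M. norm (W y * ((z * of_real (X y)) ^ k / fact k))
        \<le> norm (norm (W y) * exp (\<delta> * \<bar>X y\<bar>) + norm (W y) * exp (\<delta> * \<bar>X y\<bar>))"
    proof (rule AE_I2)
      fix y
      have "W y * ((z * of_real (X y)) ^ k / fact k)
          = W y * (\<Sum>k<Suc k. (z * of_real (X y)) ^ k / fact k) - W y * (\<Sum>k<k. (z * of_real (X y)) ^ k / fact k)"
        by (simp add: algebra_simps)
      also have "norm \<dots> \<le> norm (W y) * exp (\<delta> * \<bar>X y\<bar>) + norm (W y) * exp (\<delta> * \<bar>X y\<bar>)"
        using bound[of y "Suc k"] bound[of y k] norm_triangle_ineq4 by (smt (verit))
      finally show "norm (W y * ((z * of_real (X y)) ^ k / fact k))
        \<le> norm (norm (W y) * exp (\<delta> * \<bar>X y\<bar>) + norm (W y) * exp (\<delta> * \<bar>X y\<bar>))"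
        by simp
    qed
  qed measurable
  have "(\<lambda>m. \<integral>y. W y * (\<Sum>k<m. (z * of_real (X y)) ^ k / fact k) \<partial>M)
        \<longlonglongrightarrow> (\<integral>y. W y * exp (z * of_real (X y)) \<partial>M)"
  proof (rule integral_dominated_convergence[OF _ _ int])
    show "AE y in M. (\<lambda>m. W y * (\<Sum>k<m. (z * of_real (X y)) ^ k / fact k)) \<longlonglongrightarrow> W y * exp (z * of_real (X y))"
    proof (rule AE_I2, rule tendsto_mult_left)
      fix y
      show "(\<lambda>m. \<Sum>k<m. (z * of_real (X y)) ^ k / fact k) \<longlonglongrightarrow> exp (z * of_real (X y))"
        using exp_converges[of "z * of_real (X y)"]
        by (simp add: sums_def scaleR_conv_of_real field_simps)
    qed
  qed (use bound in auto)
  moreover have "(\<integral>y. W y * (\<Sum>k<m. (z * of_real (X y)) ^ k / fact k) \<partial>M)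
      = (\<Sum>k<m. (\<integral>y. W y * of_real (X y ^ k) \<partial>M) / fact k * z ^ k)" for m
  proof -
    have "(\<integral>y. W y * ((z * of_real (X y)) ^ k / fact k) \<partial>M)
       = (\<integral>y. W y * of_real (X y ^ k) \<partial>M) / fact k * z ^ k" for k
    proof -
      have "(\<integral>y. W y * ((z * of_real (X y)) ^ k / fact k) \<partial>M)
          = (\<integral>y. (W y * of_real (X y ^ k)) * (z ^ k / fact k) \<partial>M)"
        by (simp add: power_mult_distrib field_simps)
      then show ?thesis
        by (simp only: integral_mult_left_zero) simp
    qed
    then show ?thesis
      using term_int by (simp add: sum_distrib_left del: of_real_power)
  qed
  ultimately show ?thesis
    by (simp add: sums_def)
qed

text \<open>Zeros of a power series with a nonzero coefficient of positive index are isolated, while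
  the zero function has none isolated. The constant coefficient is read off at 0.\<close>

lemma sums_zero_imp_coeffs_zero:
  fixes a :: "nat \<Rightarrow> 'a::{real_normed_field,banach}"
  assumes "0 < r" and sums: "\<And>x. norm x < r \<Longrightarrow> (\<lambda>n. a n * x ^ n) sums 0"
  shows "a n = 0"
proof (cases "n = 0")
  case True
  then show ?thesis
    using sums_unique2[OF sums[of 0] powser_sums_zero[of a]] \<open>0 < r\<close> by simp
next
  case False
  show ?thesis
  proof (rule ccontr)
    assume "a n \<noteq> 0"
    then obtain s where s: "0 < s" "\<And>z::'a. z \<in> cball 0 s - {0} \<Longrightarrow> (0::'a) \<noteq> 0"
      using powser_0_nonzero[of r 0 a "\<lambda>_. 0" n] \<open>0 < r\<close> sums False by auto
    from s(2)[of "of_real s"] s(1) show False by simp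
  qed
qed

text \<open>
  The moments against \<open>G\<close> vanish by the power series at \<open>0\<close>. Expanding at a point \<open>t\<close> of the imaginary
  axis carries this over to all points at distance at most \<open>\<delta> / 2\<close> from \<open>t\<close>; a step of uniform
  size is possible because the exponential bound does not depend on \<open>t\<close>.
\<close>

lemma fourier_zero_of_laplace_zero:
  fixes G X :: "'a \<Rightarrow> real"
  assumes [measurable]: "X \<in> borel_measurable M"
    and "0 < \<delta>"
    and int: "\<And>s. \<bar>s\<bar> \<le> \<delta> \<Longrightarrow> integrable M (\<lambda>y. G y * exp (s * X y))"
    and zero: "\<And>s. \<bar>s\<bar> \<le> \<delta> \<Longrightarrow> (\<integral>y. G y * exp (s * X y) \<partial>M) = 0"
  shows "(\<integral>y. of_real (G y) * iexp (t * X y) \<partial>M) = 0"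
proof -
  have [measurable]: "G \<in> borel_measurable M"
    using borel_measurable_integrable[OF int[of 0]] \<open>0 < \<delta>\<close> by simp
  \<comment> \<open>Half of the exponential rate is set aside to absorb powers of \<open>X\<close>;
    the other half remains as the uniform radius of expansion.\<close>
  define \<epsilon> where "\<epsilon> = \<delta> / 2"
  have "0 < \<epsilon>" using \<open>0 < \<delta>\<close> by (simp add: \<epsilon>_def)
  have dom: "integrable M (\<lambda>y. \<bar>G y\<bar> * exp (\<delta> * \<bar>X y\<bar>))"
  proof (rule Bochner_Integration.integrable_bound)
    show "integrable M (\<lambda>y. \<bar>G y * exp (\<delta> * X y)\<bar> + \<bar>G y * exp (- \<delta> * X y)\<bar>)"
      using int[of \<delta>] int[of "- \<delta>"] \<open>0 < \<delta>\<close>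
      by (intro Bochner_Integration.integrable_add Bochner_Integration.integrable_abs) auto
    show "AE y in M. norm (\<bar>G y\<bar> * exp (\<delta> * \<bar>X y\<bar>))
        \<le> norm (\<bar>G y * exp (\<delta> * X y)\<bar> + \<bar>G y * exp (- \<delta> * X y)\<bar>)"
      by (intro AE_I2) (auto simp: abs_mult abs_if[of "X y" for y])
  qed measurable
  have dom_pow: "integrable M (\<lambda>y. \<bar>G y\<bar> * \<bar>X y\<bar> ^ n * exp (\<epsilon> * \<bar>X y\<bar>))" for n
  proof (rule Bochner_Integration.integrable_bound[OF integrable_mult_right[OF dom, of "fact n / \<epsilon> ^ n"]])
    have "norm (\<bar>G y\<bar> * \<bar>X y\<bar> ^ n * exp (\<epsilon> * \<bar>X y\<bar>))
        \<le> norm (fact n / \<epsilon> ^ n * (\<bar>G y\<bar> * exp (\<delta> * \<bar>X y\<bar>)))" for y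
    proof -
      \<comment> \<open>One term of the exponential series bounds the power of \<open>X\<close> by a
        multiple of \<open>exp (\<epsilon> * \<bar>X y\<bar>)\<close>.\<close>
      have "(\<epsilon> * \<bar>X y\<bar>) ^ n / fact n \<le> (\<Sum>k. (\<epsilon> * \<bar>X y\<bar>) ^ k / fact k)"
        using summable_exp_generic[of "\<epsilon> * \<bar>X y\<bar>"] \<open>0 < \<epsilon>\<close>
          sum_le_suminf[of "\<lambda>k. (\<epsilon> * \<bar>X y\<bar>) ^ k / fact k" "{n}"]
        by (auto simp: scaleR_conv_of_real field_simps)
      also have "\<dots> = exp (\<epsilon> * \<bar>X y\<bar>)"
        by (simp add: exp_def scaleR_conv_of_real field_simps)
      finally have "\<bar>X y\<bar> ^ n \<le> fact n / \<epsilon> ^ n * exp (\<epsilon> * \<bar>X y\<bar>)"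
        using \<open>0 < \<epsilon>\<close> by (simp add: power_mult_distrib field_simps)
      then have "\<bar>G y\<bar> * \<bar>X y\<bar> ^ n * exp (\<epsilon> * \<bar>X y\<bar>)
          \<le> \<bar>G y\<bar> * (fact n / \<epsilon> ^ n * exp (\<epsilon> * \<bar>X y\<bar>)) * exp (\<epsilon> * \<bar>X y\<bar>)"
        by (intro mult_right_mono mult_left_mono) auto
      also have "\<dots> = fact n / \<epsilon> ^ n * (\<bar>G y\<bar> * (exp (\<epsilon> * \<bar>X y\<bar>) * exp (\<epsilon> * \<bar>X y\<bar>)))"
        by (simp add: algebra_simps)
      also have "exp (\<epsilon> * \<bar>X y\<bar>) * exp (\<epsilon> * \<bar>X y\<bar>) = exp (\<delta> * \<bar>X y\<bar>)"
        by (simp add: \<epsilon>_def flip: exp_add distrib_right)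
      finally show ?thesis using \<open>0 < \<epsilon>\<close> by (simp add: abs_mult)
    qed
    then show "AE y in M. norm (\<bar>G y\<bar> * \<bar>X y\<bar> ^ n * exp (\<epsilon> * \<bar>X y\<bar>))
        \<le> norm (fact n / \<epsilon> ^ n * (\<bar>G y\<bar> * exp (\<delta> * \<bar>X y\<bar>)))" by simp
  qed measurable
  \<comment> \<open>Up to powers of the imaginary unit, \<open>m \<tau> n\<close> is the n-th
    derivative of the Fourier transform at \<tau>. All n are carried along because the expansion at
    \<tau> uses all of them.\<close>
  define m where "m \<tau> n = (\<integral>y. (of_real (G y) * of_real (X y ^ n) * iexp (\<tau> * X y)) \<partial>M)" for \<tau> n
  have m0: "m 0 n = 0" for n
  proof -
    have "(\<integral>y. G y * X y ^ n \<partial>M) / fact n = 0"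
    proof (rule sums_zero_imp_coeffs_zero[OF \<open>0 < \<epsilon>\<close>])
      fix x :: real assume "norm x < \<epsilon>"
      then show "(\<lambda>n. (\<integral>y. G y * X y ^ n \<partial>M) / fact n * x ^ n) sums 0"
        using integral_exp_expansion[of G M X \<epsilon> x] dom_pow[of 0] zero[of x] \<epsilon>_def by simp
    qed
    moreover have "m 0 n = of_real (\<integral>y. G y * X y ^ n \<partial>M)"
      unfolding m_def by (simp flip: of_real_power of_real_mult)
    ultimately show ?thesis by simp
  qed
  have step: "m (\<tau> + \<eta>) n = 0" if "\<And>n. m \<tau> n = 0" "\<bar>\<eta>\<bar> \<le> \<epsilon>" for \<tau> \<eta> n
  proof -
    let ?W = "\<lambda>y. complex_of_real (G y) * of_real (X y ^ n) * iexp (\<tau> * X y)"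
    have "(\<lambda>k. (\<integral>y. ?W y * of_real (X y ^ k) \<partial>M) / fact k * (\<i> * \<eta>) ^ k) sums
           (\<integral>y. ?W y * exp (\<i> * \<eta> * of_real (X y)) \<partial>M)"
      by (rule integral_exp_expansion[of _ _ _ \<epsilon>])
         (use dom_pow[of n] that(2) in \<open>auto simp: norm_mult norm_power power_abs\<close>)
    moreover have "(\<integral>y. ?W y * of_real (X y ^ k) \<partial>M) = m \<tau> (n + k)" for k
      unfolding m_def by (simp add: power_add mult_ac)
    moreover have "(\<integral>y. ?W y * exp (\<i> * \<eta> * of_real (X y)) \<partial>M) = m (\<tau> + \<eta>) n"
      unfolding m_def by (intro Bochner_Integration.integral_cong) (simp_all add: algebra_simps exp_add)
    ultimately have "(\<lambda>k. 0) sums m (\<tau> + \<eta>) n"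
      using that(1) by simp
    then show ?thesis using sums_unique2 sums_zero by blast
  qed
  \<comment> \<open>The segment from 0 to t is cut into \<open>N\<close> steps, each of length at
    most \<epsilon>.\<close>
  obtain N :: nat where N: "\<bar>t\<bar> / \<epsilon> < real N"
    using reals_Archimedean2 by blast
  then have "0 < N" using \<open>0 < \<epsilon>\<close> by (cases N) (auto simp: field_simps)
  with N \<open>0 < \<epsilon>\<close> have le: "\<bar>t / real N\<bar> \<le> \<epsilon>" by (simp add: field_simps)
  have "m (real j * (t / real N)) n = 0" for j n
  proof (induction j arbitrary: n)
    case (Suc j)
    then show ?case
      using step[OF _ le, of "real j * (t / real N)"] by (simp add: algebra_simps add_divide_distrib)
  qed (simp add: m0)
  from this[of N 0] \<open>0 < N\<close> show ?thesis by (simp add: m_def)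
qed

text \<open>The positive and negative parts of \<open>F\<close> have equal mass by the case s = 0.
  Once normalized, they give \<open>X\<close> two laws with the same characteristic function, so the
  laws agree on \<open>B\<close>.\<close>

lemma integral_indicator_zero_of_laplace_zero:
  fixes F X :: "'a \<Rightarrow> real"
  assumes [measurable]: "X \<in> borel_measurable M" "B \<in> sets borel"
    and "0 < \<delta>"
    and int: "\<And>s. \<bar>s\<bar> \<le> \<delta> \<Longrightarrow> integrable M (\<lambda>y. F y * exp (s * X y))"
    and zero: "\<And>s. \<bar>s\<bar> \<le> \<delta> \<Longrightarrow> (\<integral>y. F y * exp (s * X y) \<partial>M) = 0"
  shows "(\<integral>y. F y * indicator B (X y) \<partial>M) = 0"
proof -
  have intF: "integrable M F"
    using int[of 0] \<open>0 < \<delta>\<close> by simp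
  then have [measurable]: "F \<in> borel_measurable M" by auto
  define P where "P y = max 0 (F y)" for y
  define Q where "Q y = max 0 (- F y)" for y
  have F_eq: "F y = P y - Q y" for y by (auto simp: P_def Q_def)
  have intP: "integrable M P" and intQ: "integrable M Q"
    unfolding P_def Q_def using intF by (auto intro: Bochner_Integration.integrable_max)
  have nonneg: "0 \<le> P y" "0 \<le> Q y" for y by (auto simp: P_def Q_def)
  define c where "c = (\<integral>y. P y \<partial>M)"
  have "(\<integral>y. F y \<partial>M) = 0"
    using zero[of 0] \<open>0 < \<delta>\<close> by simp
  then have c': "c = (\<integral>y. Q y \<partial>M)"
    unfolding c_def F_eq using intP intQ by simp
  have "0 \<le> c" unfolding c_def by (simp add: nonneg)
  show ?thesis
  proof (cases "c = 0")
    \<comment> \<open>Without mass there is nothing to normalize, but then \<open>F\<close> vanishes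
      almost everywhere.\<close>
    case True
    then have "AE y in M. P y = 0" "AE y in M. Q y = 0"
      using integral_nonneg_eq_0_iff_AE[OF intP] integral_nonneg_eq_0_iff_AE[OF intQ] c' nonneg
      by (auto simp: c_def)
    then have "AE y in M. F y * indicator B (X y) = 0"
      by eventually_elim (simp add: F_eq)
    then show ?thesis by (simp add: integral_eq_zero_AE)
  next
    case False
    with \<open>0 \<le> c\<close> have "0 < c" by simp
    \<comment> \<open>\<open>D R\<close> is the law of \<open>X\<close> under the probability
      density \<open>R / c\<close>.\<close>
    define D where "D R = distr (density M (\<lambda>y. ennreal (R y / c))) borel X" for R
    have real_distr: "real_distribution (D R)"
      if "integrable M R" "\<And>y. 0 \<le> R y" "(\<integral>y. R y \<partial>M) = c" for R
    proof -
      have [measurable]: "R \<in> borel_measurable M" using that by auto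
      have "(\<integral>\<^sup>+y. ennreal (R y / c) \<partial>M) = ennreal (\<integral>y. R y / c \<partial>M)"
        using that \<open>0 < c\<close> by (intro nn_integral_eq_integral) auto
      also have "\<dots> = 1" using that \<open>0 < c\<close> by simp
      finally have "(\<integral>\<^sup>+y. ennreal (R y / c) * indicator (space M) y \<partial>M) = 1"
        by (subst nn_integral_cong[where v="\<lambda>y. ennreal (R y / c)"]) auto
      then have "prob_space (density M (\<lambda>y. ennreal (R y / c)))"
        by (intro prob_spaceI, subst emeasure_density) (simp_all only: space_density, measurable)
      then show ?thesis
        unfolding D_def by (rule prob_space.real_distribution_distr) simp
    qed
    have integral_D: "(\<integral>x. g x \<partial>D R) = (\<integral>y. R y *\<^sub>R g (X y) \<partial>M) /\<^sub>R c"
      if "integrable M R" "\<And>y. 0 \<le> R y" and [measurable]: "g \<in> borel_measurable borel"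
      for R and g :: "real \<Rightarrow> 'b::{banach,second_countable_topology}"
    proof -
      have [measurable]: "R \<in> borel_measurable M" using that by auto
      have "(\<integral>x. g x \<partial>D R) = (\<integral>y. (R y / c) *\<^sub>R g (X y) \<partial>M)"
        unfolding D_def using that \<open>0 < c\<close> by (simp add: integral_distr integral_density)
      also have "\<dots> = (\<integral>y. (inverse c) *\<^sub>R (R y *\<^sub>R g (X y)) \<partial>M)"
        by (simp add: divide_inverse mult.commute)
      finally show ?thesis
        by (simp only: Bochner_Integration.integral_scaleR_right)
    qed
    have "char (D P) = char (D Q)"
    proof
      fix t
      have "(\<integral>y. P y *\<^sub>R iexp (t * X y) \<partial>M) - (\<integral>y. Q y *\<^sub>R iexp (t * X y) \<partial>M)
          = (\<integral>y. P y *\<^sub>R iexp (t * X y) - Q y *\<^sub>R iexp (t * X y) \<partial>M)"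
        by (intro Bochner_Integration.integral_diff[symmetric]
              Bochner_Integration.integrable_bound[OF intP] Bochner_Integration.integrable_bound[OF intQ])
           (auto simp: P_def Q_def)
      also have "\<dots> = (\<integral>y. of_real (F y) * iexp (t * X y) \<partial>M)"
        by (simp add: F_eq scaleR_conv_of_real algebra_simps)
      also have "\<dots> = 0"
        by (rule fourier_zero_of_laplace_zero) (use \<open>0 < \<delta>\<close> int zero in auto)
      finally show "char (D P) t = char (D Q) t"
        unfolding char_def using intP intQ nonneg by (simp add: integral_D)
    qed
    then have "D P = D Q"
      using real_distr intP intQ nonneg c_def c' by (intro Levy_uniqueness) auto
    have "(\<integral>y. P y *\<^sub>R (indicator B (X y) :: real) \<partial>M) /\<^sub>R c = (\<integral>x. indicator B x \<partial>D P)"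
      by (rule integral_D[symmetric]) (use intP nonneg in auto)
    also have "\<dots> = (\<integral>x. indicator B x \<partial>D Q)"
      by (simp only: \<open>D P = D Q\<close>)
    also have "\<dots> = (\<integral>y. Q y *\<^sub>R (indicator B (X y) :: real) \<partial>M) /\<^sub>R c"
      by (rule integral_D) (use intQ nonneg in auto)
    finally have "(\<integral>y. P y * indicator B (X y) \<partial>M) = (\<integral>y. Q y * indicator B (X y) \<partial>M)"
      using \<open>0 < c\<close> by simp
    moreover have "integrable M (\<lambda>y. P y * indicator B (X y))"
      by (rule Bochner_Integration.integrable_bound[OF intP]) (auto simp: P_def split: split_indicator)
    moreover have "integrable M (\<lambda>y. Q y * indicator B (X y))"
      by (rule Bochner_Integration.integrable_bound[OF intQ]) (auto simp: Q_def split: split_indicator)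
    ultimately show ?thesis
      unfolding F_eq left_diff_distrib by simp
  qed
qed

section \<open>From one coordinate to Borel sets in several dimensions\<close>

text \<open>Induction on the set \<open>I\<close> of coordinates whose exponential factor has
  already become an indicator; there \<theta> is 0. Since \<theta> stays arbitrary in the induction,
  the next coordinate \<open>j\<close> can be varied freely and the one-dimensional result applied
  to it.\<close>

lemma integral_prod_indicator_zero_of_laplace_zero:
  fixes F :: "'a \<Rightarrow> real" and T :: "'a \<Rightarrow> real ^ 'd"
  assumes T[measurable]: "T \<in> borel_measurable M"
    and "0 < \<delta>"
    and int: "\<And>\<theta>. (\<And>i. \<bar>\<theta> $ i\<bar> \<le> \<delta>) \<Longrightarrow> integrable M (\<lambda>y. F y * exp (\<theta> \<bullet> T y))"
    and zero: "\<And>\<theta>. (\<And>i. \<bar>\<theta> $ i\<bar> \<le> \<delta>) \<Longrightarrow> (\<integral>y. F y * exp (\<theta> \<bullet> T y) \<partial>M) = 0"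
    and B[measurable]: "\<And>i. B i \<in> sets borel"
    and "finite I"
    and "\<And>i. \<bar>\<theta> $ i\<bar> \<le> \<delta>" and "\<And>i. i \<in> I \<Longrightarrow> \<theta> $ i = 0"
  shows "(\<integral>y. F y * exp (\<theta> \<bullet> T y) * (\<Prod>i\<in>I. indicator (B i) (T y $ i)) \<partial>M) = 0"
  using \<open>finite I\<close> assms(7,8)
proof (induction I arbitrary: \<theta> rule: finite_induct)
  case empty
  then show ?case using zero by simp
next
  case (insert j I)
  let ?Pr = "\<lambda>y. \<Prod>i\<in>I. indicator (B i) (T y $ i) :: real"
  have [measurable]: "(\<lambda>y. T y $ i) \<in> borel_measurable M" for i
    by (rule measurable_compose[OF T borel_measurable_nth])
  have [measurable]: "?Pr \<in> borel_measurable M"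
    by (intro borel_measurable_prod borel_measurable_indicator') measurable
  have shift: "\<bar>(\<theta> + s *\<^sub>R axis j 1) $ i\<bar> \<le> \<delta>" if "\<bar>s\<bar> \<le> \<delta>" for s i
    using that insert.prems by (auto simp: axis_def)
  \<comment> \<open>The one-dimensional parameter s becomes the \<open>j\<close>-th coordinate of
    the exponent, which is 0 in \<theta>.\<close>
  have split: "F y * exp (\<theta> \<bullet> T y) * ?Pr y * exp (s * T y $ j)
      = F y * exp ((\<theta> + s *\<^sub>R axis j 1) \<bullet> T y) * ?Pr y" for s y
    by (simp add: inner_add_left inner_axis' exp_add)
  have "(\<integral>y. F y * exp (\<theta> \<bullet> T y) * ?Pr y * indicator (B j) (T y $ j) \<partial>M) = 0"
  proof (rule integral_indicator_zero_of_laplace_zero[OF _ _ \<open>0 < \<delta>\<close>])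
    fix s :: real assume s: "\<bar>s\<bar> \<le> \<delta>"
    note int' = int[OF shift[OF s]]
    have [measurable]: "(\<lambda>y. F y * exp ((\<theta> + s *\<^sub>R axis j 1) \<bullet> T y)) \<in> borel_measurable M"
      using int' by (rule borel_measurable_integrable)
    have "\<bar>?Pr y\<bar> \<le> 1" for y
      by (auto simp: abs_prod intro!: prod_le_1 split: split_indicator)
    then have "integrable M (\<lambda>y. F y * exp ((\<theta> + s *\<^sub>R axis j 1) \<bullet> T y) * ?Pr y)"
      by (intro Bochner_Integration.integrable_bound[OF int'])
         (auto simp: abs_mult intro!: mult_left_le)
    then show "integrable M (\<lambda>y. F y * exp (\<theta> \<bullet> T y) * ?Pr y * exp (s * T y $ j))"
      by (simp only: split)
    have "(\<integral>y. F y * exp ((\<theta> + s *\<^sub>R axis j 1) \<bullet> T y) * ?Pr y \<partial>M) = 0"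
      using insert.hyps insert.prems s by (intro insert.IH shift) (auto simp: axis_def)
    then show "(\<integral>y. F y * exp (\<theta> \<bullet> T y) * ?Pr y * exp (s * T y $ j) \<partial>M) = 0"
      by (simp only: split)
  qed auto
  then show ?case
    using insert.hyps by (simp add: mult_ac)
qed

lemma sets_borel_subset_sigma_sets_boxes:
  "sets (borel :: (real ^ 'd) measure)
    \<subseteq> sigma_sets UNIV {{x. \<forall>i. x $ i \<in> B i} | B. \<forall>i. B i \<in> sets borel}"
proof -
  have "box a b \<in> {{x. \<forall>i. x $ i \<in> B i} | B. \<forall>i. B i \<in> sets borel}" for a b :: "real ^ 'd"
    by (rule CollectI, rule exI[of _ "\<lambda>i. {a $ i <..< b $ i}"]) (auto simp: mem_box_cart)
  then have "range (\<lambda>(a, b). box a b :: (real ^ 'd) set)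
      \<subseteq> {{x. \<forall>i. x $ i \<in> B i} | B. \<forall>i. B i \<in> sets borel}"
    by auto
  then show ?thesis
    unfolding borel_eq_box by (simp add: sigma_sets_mono')
qed

text \<open>Dynkin's \<pi>-\<lambda> argument: boxes with Borel sides are stable under intersection
  and generate the Borel sets. Complements are covered because the total integral is 0, disjoint
  unions by dominated convergence.\<close>

lemma integral_vimage_zero_of_laplace_zero:
  fixes F :: "'a \<Rightarrow> real" and T :: "'a \<Rightarrow> real ^ 'd"
  assumes T[measurable]: "T \<in> borel_measurable M"
    and "0 < \<delta>"
    and int: "\<And>\<theta>. (\<And>i. \<bar>\<theta> $ i\<bar> \<le> \<delta>) \<Longrightarrow> integrable M (\<lambda>y. F y * exp (\<theta> \<bullet> T y))"
    and zero: "\<And>\<theta>. (\<And>i. \<bar>\<theta> $ i\<bar> \<le> \<delta>) \<Longrightarrow> (\<integral>y. F y * exp (\<theta> \<bullet> T y) \<partial>M) = 0"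
    and "C \<in> sets borel"
  shows "(\<integral>y. F y * indicator C (T y) \<partial>M) = 0"
proof -
  let ?E = "{{x :: real ^ 'd. \<forall>i. x $ i \<in> B i} | B. \<forall>i. B i \<in> sets borel}"
  have intF: "integrable M F"
    using int[of 0] \<open>0 < \<delta>\<close> by simp
  then have [measurable]: "F \<in> borel_measurable M" by auto
  have int_ind: "integrable M (\<lambda>y. F y * indicator A (T y))" if [measurable]: "A \<in> sets borel" for A
    by (rule Bochner_Integration.integrable_bound[OF intF]) (auto split: split_indicator)
  have E_borel: "?E \<subseteq> sets borel"
  proof clarify
    fix B :: "'d \<Rightarrow> real set"
    assume "\<forall>i. B i \<in> sets borel"
    then have [measurable]: "B i \<in> sets borel" for i by simp
    have "{x \<in> space borel. \<forall>i. x $ i \<in> B i} \<in> sets (borel :: (real ^ 'd) measure)" by measurable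
    then show "{x. \<forall>i. x $ i \<in> B i} \<in> sets borel" by simp
  qed
  have borel: "A \<in> sets borel" if "A \<in> sigma_sets UNIV ?E" for A
    using that sets.sigma_sets_subset[OF E_borel] by auto
  have "Int_stable ?E"
  proof (rule Int_stableI, clarify)
    fix B B' :: "'d \<Rightarrow> real set"
    assume "\<forall>i. B i \<in> sets borel" "\<forall>i. B' i \<in> sets borel"
    then show "\<exists>B''. {x. \<forall>i. x $ i \<in> B i} \<inter> {x. \<forall>i. x $ i \<in> B' i} = {x. \<forall>i. x $ i \<in> B'' i}
        \<and> (\<forall>i. B'' i \<in> sets borel)"
      by (intro exI[of _ "\<lambda>i. B i \<inter> B' i"]) auto
  qed
  moreover have "?E \<subseteq> Pow UNIV" by simp
  moreover have "C \<in> sigma_sets UNIV ?E"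
    using \<open>C \<in> sets borel\<close> sets_borel_subset_sigma_sets_boxes by blast
  ultimately show ?thesis
  proof (induction rule: sigma_sets_induct_disjoint)
    case (basic A)
    then obtain B where B: "A = {x. \<forall>i. x $ i \<in> B i}" "\<And>i. B i \<in> sets borel" by auto
    \<comment> \<open>With \<theta> = 0 and all coordinates in the index set, only the indicator of
      the box remains.\<close>
    have "(\<integral>y. F y * exp (0 \<bullet> T y) * (\<Prod>i\<in>UNIV. indicator (B i) (T y $ i)) \<partial>M) = 0"
      by (rule integral_prod_indicator_zero_of_laplace_zero[OF T \<open>0 < \<delta>\<close> int zero B(2)])
         (use \<open>0 < \<delta>\<close> in auto)
    moreover have "indicator A x = (\<Prod>i\<in>UNIV. indicator (B i) (x $ i) :: real)" for x
      by (auto simp: B(1) indicator_def prod.If_cases)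
    ultimately show ?case by simp
  next
    case (compl A)
    have "(\<integral>y. F y * indicator (UNIV - A) (T y) \<partial>M) = (\<integral>y. F y - F y * indicator A (T y) \<partial>M)"
      by (intro Bochner_Integration.integral_cong) (auto split: split_indicator)
    also have "\<dots> = (\<integral>y. F y \<partial>M) - (\<integral>y. F y * indicator A (T y) \<partial>M)"
      by (intro Bochner_Integration.integral_diff intF int_ind borel compl)
    also have "\<dots> = 0"
      using compl zero[of 0] \<open>0 < \<delta>\<close> by simp
    finally show ?case .
  next
    case (union A)
    have [measurable]: "A n \<in> sets borel" for n using union borel by blast
    have "(\<lambda>n. F y * indicator (A n) (T y)) sums (F y * indicator (\<Union>n. A n) (T y))" for y
      using sums_mult[OF indicator_sums[of A]] union(1) by (auto simp: disjoint_family_on_def)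
    then have lim: "(\<lambda>N. \<Sum>n<N. F y * indicator (A n) (T y)) \<longlonglongrightarrow> F y * indicator (\<Union>n. A n) (T y)" for y
      by (simp add: sums_def)
    have part: "(\<Sum>n<N. F y * indicator (A n) (T y)) = F y * indicator (\<Union>n<N. A n) (T y)" for N y
      using union(1) indicator_UN_disjoint[of "{..<N}" A "T y"]
      by (subst indicator_UN_disjoint) (auto simp: sum_distrib_left intro: disjoint_family_on_mono)
    have "(\<lambda>N. \<integral>y. (\<Sum>n<N. F y * indicator (A n) (T y)) \<partial>M)
        \<longlonglongrightarrow> (\<integral>y. F y * indicator (\<Union>n. A n) (T y) \<partial>M)"
    proof (rule integral_dominated_convergence[OF _ _ Bochner_Integration.integrable_abs[OF intF]])
      show "AE y in M. norm (\<Sum>n<N. F y * indicator (A n) (T y)) \<le> \<bar>F y\<bar>" for N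
        unfolding part by (auto split: split_indicator)
      show "(\<lambda>y. F y * indicator (\<Union>n. A n) (T y)) \<in> borel_measurable M"
        by (intro borel_measurable_integrable int_ind) auto
    qed (use lim in auto)
    moreover have "(\<integral>y. (\<Sum>n<N. F y * indicator (A n) (T y)) \<partial>M) = 0" for N
      by (subst Bochner_Integration.integral_sum) (use union int_ind borel in auto)
    ultimately show ?case by (simp only: LIMSEQ_const_iff)
  qed auto
qed

section \<open>From vanishing integrals to vanishing almost everywhere\<close>

text \<open>
  The hypothesis \<open>sign\<close> says that the sign of \<open>F\<close> is a function of \<open>T\<close>, but this function is not
  assumed to be Borel. By inner regularity on the graph of \<open>T\<close>, the set where \<open>F > 0\<close> is exhausted by
  preimages under \<open>T\<close> of compact sets.
\<close>

lemma AE_nonpos_of_integral_vimage_zero: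
  fixes F :: "'a::polish_space \<Rightarrow> real" and T :: "'a \<Rightarrow> 'b::polish_space"
  assumes A[measurable]: "A \<in> sets borel"
    and sets_M: "sets M = sets (restrict_space borel A)"
    and T: "T \<in> borel_measurable M"
    and F: "integrable M F"
    and zero: "\<And>C. C \<in> sets borel \<Longrightarrow> (\<integral>y. F y * indicator C (T y) \<partial>M) = 0"
    and sign: "\<And>x y. x \<in> A \<Longrightarrow> y \<in> A \<Longrightarrow> T x = T y \<Longrightarrow> 0 \<le> F x * F y"
  shows "AE y in M. F y \<le> 0"
proof -
  note [measurable] = T
  have [measurable]: "F \<in> borel_measurable M" using F by auto
  have space_M: "space M = A"
    using sets_eq_imp_space_eq[OF sets_M] by (simp add: space_restrict_space)
  have [measurable]: "(\<lambda>y. y) \<in> borel_measurable M"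
    unfolding measurable_cong_sets[OF sets_M refl] by (rule measurable_restrict_space1) simp
  define \<nu> where "\<nu> = density M (\<lambda>y. ennreal (max 0 (F y)))"
  have emeasure_\<nu>: "emeasure \<nu> D = (\<integral>\<^sup>+y. ennreal (max 0 (F y)) * indicator D y \<partial>M)"
    if "D \<in> sets M" for D
    unfolding \<nu>_def using that by (intro emeasure_density) auto
  have intP: "integrable M (\<lambda>y. max 0 (F y))"
    using F by (intro Bochner_Integration.integrable_max) auto
  \<comment> \<open>\<open>T\<close> need not be continuous, so it may map compact sets to sets that
    are not compact. On its graph it becomes the second projection, which is continuous; hence the
    measure is moved to the graph.\<close>
  define \<kappa> where "\<kappa> = distr \<nu> borel (\<lambda>y. (y, T y))"
  have graph_meas: "(\<lambda>y. (y, T y)) \<in> borel_measurable \<nu>"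
    unfolding \<nu>_def by simp
  have emeasure_\<kappa>: "emeasure \<kappa> K = emeasure \<nu> {y \<in> A. (y, T y) \<in> K}" if "K \<in> sets borel" for K
    unfolding \<kappa>_def using that graph_meas
    by (subst emeasure_distr) (auto simp: \<nu>_def space_M intro!: arg_cong[where f="emeasure _"])
  have finite: "emeasure \<kappa> (space \<kappa>) \<noteq> \<infinity>"
  proof -
    have "emeasure \<kappa> (space \<kappa>) = emeasure \<nu> A"
      using emeasure_\<kappa>[of UNIV] by (simp add: \<kappa>_def)
    also have "\<dots> \<le> (\<integral>\<^sup>+y. ennreal (max 0 (F y)) \<partial>M)"
      using sets.top[of M] by (subst emeasure_\<nu>) (auto simp: space_M intro!: nn_integral_mono split: split_indicator)
    also have "\<dots> = ennreal (\<integral>y. max 0 (F y) \<partial>M)"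
      using intP by (intro nn_integral_eq_integral) auto
    finally show ?thesis by (auto simp: top_unique)
  qed
  \<comment> \<open>Extending by constants off \<open>A\<close> gives Borel functions on the whole
    space, from which the part of the graph over \<open>F > 0\<close> is seen to be Borel. Equality
    with the second coordinate is expressed as distance 0, a measurable real function.\<close>
  define T' where "T' y = (if y \<in> A then T y else undefined)" for y
  define F' where "F' y = (if y \<in> A then F y else 0)" for y
  have [measurable]: "T' \<in> borel_measurable borel"
    unfolding T'_def
    by (rule measurable_If_restrict_space_iff[THEN iffD2])
       (auto simp: measurable_cong_sets[OF sets_M[symmetric] refl] )
  have [measurable]: "F' \<in> borel_measurable borel"
    unfolding F'_def
    by (rule measurable_If_restrict_space_iff[THEN iffD2])
       (auto simp: measurable_cong_sets[OF sets_M[symmetric] refl] )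
  define G where "G = {p. fst p \<in> A \<and> 0 < F' (fst p) \<and> dist (T' (fst p)) (snd p) = 0}"
  have "Measurable.pred borel (\<lambda>p. fst p \<in> A \<and> 0 < F' (fst p) \<and> dist (T' (fst p)) (snd p :: 'b) = 0)"
    unfolding borel_prod[symmetric] by measurable
  then have G[measurable]: "G \<in> sets borel"
    by (simp add: G_def pred_def)
  have G_iff: "(y, t) \<in> G \<longleftrightarrow> y \<in> A \<and> 0 < F y \<and> T y = t" for y t
    by (auto simp: G_def F'_def T'_def)
  have "emeasure \<kappa> K = 0" if K: "K \<subseteq> G" "compact K" for K
  proof -
    have C: "snd ` K \<in> sets borel"
      using K by (intro borel_compact compact_continuous_image continuous_intros)
    then have [measurable]: "{y \<in> A. T y \<in> snd ` K} \<in> sets M"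
      using measurable_sets[OF T C] by (simp add: vimage_def Int_def space_M conj_commute)
    have nonneg: "0 \<le> F y" if y: "y \<in> A" "T y \<in> snd ` K" for y
    proof -
      from y obtain x where "(x, T y) \<in> G" using K by auto
      then show ?thesis using sign[of x y] y by (auto simp: G_iff zero_le_mult_iff)
    qed
    have "emeasure \<kappa> K = emeasure \<nu> {y \<in> A. (y, T y) \<in> K}"
      using K by (intro emeasure_\<kappa> borel_compact)
    also have "\<dots> \<le> emeasure \<nu> {y \<in> A. T y \<in> snd ` K}"
      by (intro emeasure_mono) (auto simp: \<nu>_def intro: rev_image_eqI)
    also have "\<dots> = (\<integral>\<^sup>+y. ennreal (max 0 (F y)) * indicator {y \<in> A. T y \<in> snd ` K} y \<partial>M)"
      by (rule emeasure_\<nu>) measurable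
    also have "\<dots> = (\<integral>\<^sup>+y. ennreal (F y * indicator (snd ` K) (T y)) \<partial>M)"
      using nonneg by (intro nn_integral_cong) (auto simp: space_M split: split_indicator)
    also have "\<dots> = ennreal (\<integral>y. F y * indicator (snd ` K) (T y) \<partial>M)"
    proof (rule nn_integral_eq_integral)
      show "integrable M (\<lambda>y. F y * indicator (snd ` K) (T y))"
        using C by (intro Bochner_Integration.integrable_bound[OF F]) (auto split: split_indicator)
      show "AE y in M. 0 \<le> F y * indicator (snd ` K) (T y)"
        using nonneg by (intro AE_I2) (auto simp: space_M split: split_indicator)
    qed
    also have "\<dots> = 0" using zero[OF C] by simp
    finally show ?thesis by simp
  qed
  then have "(SUP K \<in> {K. K \<subseteq> G \<and> compact K}. emeasure \<kappa> K) \<le> 0"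
    by (intro SUP_least) auto
  then have "emeasure \<kappa> G = 0"
    using inner_regular[of \<kappa> G] finite by (simp add: \<kappa>_def)
  then have "emeasure \<nu> {y \<in> A. 0 < F y} = 0"
    using emeasure_\<kappa>[OF G] by (simp add: G_iff cong: conj_cong)
  moreover have "{y \<in> A. 0 < F y} \<in> sets M"
    unfolding space_M[symmetric] by measurable
  ultimately have "AE y in M. ennreal (max 0 (F y)) * indicator {y \<in> A. 0 < F y} y = 0"
    by (simp add: emeasure_\<nu> nn_integral_0_iff_AE)
  then show ?thesis
    using AE_space by eventually_elim (auto simp: space_M split: split_indicator_asm if_splits)
qed

lemma AE_zero_of_integral_vimage_zero:
  fixes F :: "'a::polish_space \<Rightarrow> real" and T :: "'a \<Rightarrow> 'b::polish_space"
  assumes "A \<in> sets borel"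
    and "sets M = sets (restrict_space borel A)"
    and "T \<in> borel_measurable M"
    and "integrable M F"
    and "\<And>C. C \<in> sets borel \<Longrightarrow> (\<integral>y. F y * indicator C (T y) \<partial>M) = 0"
    and "\<And>x y. x \<in> A \<Longrightarrow> y \<in> A \<Longrightarrow> T x = T y \<Longrightarrow> 0 \<le> F x * F y"
  shows "AE y in M. F y = 0"
proof -
  have "AE y in M. F y \<le> 0"
    by (rule AE_nonpos_of_integral_vimage_zero[OF assms])
  moreover have "AE y in M. - F y \<le> 0"
    by (rule AE_nonpos_of_integral_vimage_zero[OF assms(1-3)]) (use assms(4-6) in auto)
  ultimately show ?thesis by eventually_elim simp
qed

section \<open>The sample space and the likelihood of the family\<close>

text \<open>This serves to show that the sample space is not a null set, hence that the normalizing
  integral of the deformed density is positive.\<close>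

lemma emeasure_lborel_sample_space:
  assumes [measurable]: "S \<in> sets borel"
  shows "sample_space S \<in> sets (borel :: (real ^ 'n) measure)"
    and "emeasure lborel (sample_space S :: (real ^ 'n) set) = emeasure lborel S ^ CARD('n)"
proof -
  have "{y \<in> space borel. \<forall>j. y $ j \<in> S} \<in> sets (borel :: (real ^ 'n) measure)"
    by measurable
  then show meas: "sample_space S \<in> sets (borel :: (real ^ 'n) measure)"
    by (simp add: sample_space_def)
  have ind: "(indicator (sample_space S) y :: ennreal) = (\<Prod>b\<in>Basis. indicator S (y \<bullet> b))" for y :: "real ^ 'n"
  proof -
    have "y \<in> sample_space S \<longleftrightarrow> (\<forall>b\<in>Basis. y \<bullet> b \<in> S)"
      by (auto simp: sample_space_def Basis_vec_def inner_axis)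
    then show ?thesis
      by (cases "y \<in> sample_space S") (auto simp: prod_zero_iff indicator_eq_0_iff)
  qed
  have "emeasure lborel (sample_space S :: (real ^ 'n) set) = (\<integral>\<^sup>+y. indicator (sample_space S :: (real ^ 'n) set) y \<partial>lborel)"
    using meas by simp
  also have "\<dots> = (\<Prod>b\<in>(Basis :: (real ^ 'n) set). (\<integral>\<^sup>+x. indicator S x \<partial>lborel))"
    unfolding ind by (rule nn_integral_lborel_prod) auto
  finally show "emeasure lborel (sample_space S :: (real ^ 'n) set) = emeasure lborel S ^ CARD('n)"
    by simp
qed

text \<open>On the support the power \<alpha> - 1 undoes the exponent of the density and returns the
  bracket, which is affine in \<open>w l\<close>. The three summands depend on the sample only, on
  the parameter only, and on both through an inner product.\<close>

lemma gen_likelihood_sample_space: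
  fixes y :: "real ^ 'n"
  assumes "\<alpha> \<noteq> 1" and fam: "B_family \<alpha> \<Lambda> S h Z w f p" and "l \<in> \<Lambda>" and y: "y \<in> sample_space S"
  shows "gen_likelihood \<alpha> p y l
      = \<alpha> / (\<alpha> - 1) * (\<Sum>j\<in>UNIV. h (y $ j)) / real CARD('n)
        + (\<alpha> / (\<alpha> - 1) * Z l - 1 / (\<alpha> - 1) - (\<integral>x. p l x powr \<alpha> \<partial>lborel))
        + w l \<bullet> ((\<alpha> / (\<alpha> - 1)) *\<^sub>R mean_statistic f y)"
proof -
  have "p l (y $ j) powr (\<alpha> - 1) = h (y $ j) + Z l + w l \<bullet> f (y $ j)" for j
  proof -
    have "y $ j \<in> S" using y by (simp add: sample_space_def)
    then have "0 < h (y $ j) + Z l + w l \<bullet> f (y $ j)"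
      and "p l (y $ j) = (h (y $ j) + Z l + w l \<bullet> f (y $ j)) powr (1 / (\<alpha> - 1))"
      using fam \<open>l \<in> \<Lambda>\<close> unfolding B_family_def by blast+
    then show ?thesis
      using \<open>\<alpha> \<noteq> 1\<close> by (simp add: powr_powr)
  qed
  then have "(\<alpha> * p l (y $ j) powr (\<alpha> - 1) - 1) / (\<alpha> - 1)
      = \<alpha> / (\<alpha> - 1) * h (y $ j) + (\<alpha> / (\<alpha> - 1) * Z l - 1 / (\<alpha> - 1)) + \<alpha> / (\<alpha> - 1) * (w l \<bullet> f (y $ j))" for j
    by (simp add: diff_divide_distrib add_divide_distrib distrib_left)
  then have "gen_likelihood \<alpha> p y l
      = (1 / real CARD('n)) * (\<Sum>j\<in>UNIV. \<alpha> / (\<alpha> - 1) * h (y $ j)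
            + (\<alpha> / (\<alpha> - 1) * Z l - 1 / (\<alpha> - 1)) + \<alpha> / (\<alpha> - 1) * (w l \<bullet> f (y $ j)))
        - (\<integral>x. p l x powr \<alpha> \<partial>lborel)"
    by (simp only: gen_likelihood_def)
  also have "\<dots> = \<alpha> / (\<alpha> - 1) * (\<Sum>j\<in>UNIV. h (y $ j)) / real CARD('n)
        + (\<alpha> / (\<alpha> - 1) * Z l - 1 / (\<alpha> - 1) - (\<integral>x. p l x powr \<alpha> \<partial>lborel))
        + \<alpha> / (\<alpha> - 1) * ((1 / real CARD('n)) * (\<Sum>j\<in>UNIV. w l \<bullet> f (y $ j)))"
    by (simp only: sum.distrib sum_distrib_left[symmetric] distrib_left sum_constant) (simp add: mult.commute)
  also have "(1 / real CARD('n)) * (\<Sum>j\<in>UNIV. w l \<bullet> f (y $ j)) = w l \<bullet> mean_statistic f y"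
  proof -
    have "mean_statistic f y = (1 / real CARD('n)) *\<^sub>R (\<Sum>j\<in>UNIV. f (y $ j))"
      by (simp add: mean_statistic_def vec_eq_iff)
    then show ?thesis by (simp add: inner_sum_right)
  qed
  finally show ?thesis by simp
qed

text \<open>A density vanishing off a null set could not have total mass 1.\<close>

lemma B_family_support:
  assumes fam: "B_family \<alpha> \<Lambda> S h Z w f p" and "l \<in> \<Lambda>"
  shows "S \<in> sets borel" and "emeasure lborel S \<noteq> 0"
proof -
  have [measurable]: "p l \<in> borel_measurable borel" and S: "S = {y. 0 < p l y}"
    and outside: "\<And>y. y \<notin> S \<Longrightarrow> p l y = 0"
    and "prob_space (density lborel (\<lambda>y. ennreal (p l y)))"
    using fam \<open>l \<in> \<Lambda>\<close> unfolding B_family_def by blast+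
  have "{y \<in> space borel. 0 < p l y} \<in> sets borel" by measurable
  then show meas: "S \<in> sets borel" by (simp add: S)
  show "emeasure lborel S \<noteq> 0"
  proof
    assume "emeasure lborel S = 0"
    then have "AE y in lborel. y \<notin> S"
      using meas by (intro AE_not_in) auto
    then have "AE y in lborel. ennreal (p l y) = 0"
      by eventually_elim (simp add: outside)
    then have "(\<integral>\<^sup>+y. ennreal (p l y) \<partial>lborel) = 0"
      by (simp add: nn_integral_0_iff_AE)
    moreover have "(\<integral>\<^sup>+y. ennreal (p l y) \<partial>lborel) = 1"
      using prob_space.emeasure_space_1[OF \<open>prob_space _\<close>] by (simp add: emeasure_density)
    ultimately show False by simp
  qed
qed

section \<open>Generalized completeness of the mean statistic\<close>

theorem theorem4p2:
  fixes \<alpha> :: real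
    and \<Lambda> :: "(real ^ 'k) set"
    and S :: "real set"
    and h :: "real \<Rightarrow> real"
    and Z :: "real ^ 'k \<Rightarrow> real"
    and w :: "real ^ 'k \<Rightarrow> real ^ 'd"
    and f :: "real \<Rightarrow> real ^ 'd"
    and p :: "real ^ 'k \<Rightarrow> real \<Rightarrow> real"
  assumes "\<alpha> > 0" and "\<alpha> \<noteq> 1"
    and "B_family \<alpha> \<Lambda> S h Z w f p"
    and "\<And>l. l \<in> \<Lambda> \<Longrightarrow> integrable lborel (\<lambda>x. p l x powr \<alpha>)"
    and "\<And>l. l \<in> \<Lambda> \<Longrightarrow>
           set_integrable lborel (sample_space S :: (real ^ 'n) set)
             (\<lambda>r. exp (gen_likelihood \<alpha> p r l))"
    and "\<exists>a b :: real ^ 'd. (\<forall>i. a $ i < b $ i) \<and> cbox a b \<subseteq> w ` \<Lambda>"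
  shows "generalized_complete \<alpha> \<Lambda> S p (mean_statistic f :: real ^ 'n \<Rightarrow> real ^ 'd)"
proof -
  let ?A = "sample_space S :: (real ^ 'n) set"
  let ?M = "restrict_space lborel ?A"
  let ?L = "\<lambda>l y :: real ^ 'n. gen_likelihood \<alpha> p y l"
  define c where "c = \<alpha> / (\<alpha> - 1)"
  have "c \<noteq> 0" using assms(1,2) by (simp add: c_def)
  obtain a b :: "real ^ 'd" where ab: "\<And>i. a $ i < b $ i" and cbox: "cbox a b \<subseteq> w ` \<Lambda>"
    using assms(6) by blast
  \<comment> \<open>The centre of the rectangle and its smallest half side: the cube of radius
    \<delta> about \<open>m\<close> lies in the rectangle.\<close>
  define m where "m = (1 / 2) *\<^sub>R (a + b)"
  define \<delta> where "\<delta> = Min (range (\<lambda>i. (b $ i - a $ i) / 2))"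
  have "0 < \<delta>" using ab by (auto simp: \<delta>_def)
  have "\<exists>l. l \<in> \<Lambda> \<and> w l = m + \<theta>" if "\<And>i. \<bar>\<theta> $ i\<bar> \<le> \<delta>" for \<theta>
  proof -
    have half: "\<bar>\<theta> $ i\<bar> \<le> (b $ i - a $ i) / 2" for i
    proof -
      have "\<delta> \<le> (b $ i - a $ i) / 2" unfolding \<delta>_def by (intro Min_le) auto
      with that[of i] show ?thesis by linarith
    qed
    have "a $ i \<le> (m + \<theta>) $ i \<and> (m + \<theta>) $ i \<le> b $ i" for i
      using half[of i] unfolding abs_le_iff by (simp add: m_def field_simps)
    then have "m + \<theta> \<in> w ` \<Lambda>"
      using cbox by (auto simp: mem_box_cart)
    then show ?thesis by auto
  qed
  then obtain param where param: "param \<theta> \<in> \<Lambda>" "w (param \<theta>) = m + \<theta>" if "\<And>i. \<bar>\<theta> $ i\<bar> \<le> \<delta>" for \<theta>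
    by metis
  have param0: "param 0 \<in> \<Lambda>" "w (param 0) = m"
    using param[of 0] \<open>0 < \<delta>\<close> by auto
  have S: "S \<in> sets borel" "emeasure lborel S \<noteq> 0"
    using B_family_support[OF assms(3) param0(1)] by auto
  have A[measurable]: "?A \<in> sets borel"
    using emeasure_lborel_sample_space(1)[OF S(1)] .
  have space_M: "space ?M = ?A" by (simp add: space_restrict_space)

  define K where "K l = c * Z l - 1 / (\<alpha> - 1) - (\<integral>x. p l x powr \<alpha> \<partial>lborel)" for l
  define T where "T y = c *\<^sub>R mean_statistic f y" for y :: "real ^ 'n"
  have L_eq: "?L l y = c * (\<Sum>j\<in>UNIV. h (y $ j)) / real CARD('n) + K l + w l \<bullet> T y"
    if "l \<in> \<Lambda>" "y \<in> ?A" for l y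
    unfolding K_def T_def c_def by (rule gen_likelihood_sample_space[OF assms(2,3) that])
  \<comment> \<open>The summand with \<open>h\<close> cancels, so changing the parameter tilts the
    density by an exponential in \<open>T\<close>.\<close>
  have L_diff: "?L l y - ?L (param 0) y = K l - K (param 0) + (w l - m) \<bullet> T y"
    if "l \<in> \<Lambda>" "y \<in> ?A" for l y
    using that param0 by (simp add: L_eq inner_diff_left)
  have exp_L: "integrable ?M (\<lambda>y. exp (?L l y))" if "l \<in> \<Lambda>" for l
    using assms(5)[OF that] by (simp add: integrable_restrict_space set_integrable_def)
  have L_meas: "?L l \<in> borel_measurable ?M" if "l \<in> \<Lambda>" for l
    using borel_measurable_ln[OF borel_measurable_integrable[OF exp_L[OF that]]] by simp
  \<comment> \<open>\<open>f\<close> is not assumed measurable. Each coordinate of \<open>T\<close>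
    is recovered from the difference of the likelihoods at the parameters for
    \<open>m + \<delta> *\<^sub>R axis i 1\<close> and \<open>m\<close>; these are measurable as
    logarithms of integrable functions.\<close>
  have T_meas: "T \<in> borel_measurable ?M"
  proof (rule borel_measurable_euclidean_space[THEN iffD2], rule ballI)
    fix e :: "real ^ 'd" assume "e \<in> Basis"
    then obtain i where e: "e = axis i 1" by (auto simp: Basis_vec_def)
    let ?l = "param (\<delta> *\<^sub>R axis i 1)"
    have l: "?l \<in> \<Lambda>" "w ?l = m + \<delta> *\<^sub>R axis i 1"
      using \<open>0 < \<delta>\<close> by (auto intro!: param simp: axis_def)
    have "T y \<bullet> e = (?L ?l y - ?L (param 0) y - (K ?l - K (param 0))) / \<delta>" if "y \<in> ?A" for y
      using L_diff[OF l(1) that] \<open>0 < \<delta>\<close> by (simp add: l(2) e inner_commute)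
    moreover have "(\<lambda>y. (?L ?l y - ?L (param 0) y - (K ?l - K (param 0))) / \<delta>) \<in> borel_measurable ?M"
      using L_meas[OF l(1)] L_meas[OF param0(1)] by measurable
    ultimately show "(\<lambda>y. T y \<bullet> e) \<in> borel_measurable ?M"
      by (subst measurable_cong) (auto simp: space_M)
  qed

  let ?D = "\<lambda>l. LINT r:?A|lborel. exp (?L l r)"
  have D_eq: "?D l = (\<integral>y. exp (?L l y) \<partial>?M)" for l
    by (simp add: integral_restrict_space set_lebesgue_integral_def)
  \<comment> \<open>A strictly positive integrand has integral 0 only if the sample space is a null
    set.\<close>
  have D_pos: "0 < ?D l" if "l \<in> \<Lambda>" for l
  proof -
    have "?D l \<noteq> 0"
    proof
      assume "?D l = 0"
      then have "AE y in ?M. exp (?L l y) = 0"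
        using integral_nonneg_eq_0_iff_AE[OF exp_L[OF that]] by (simp add: D_eq)
      then have "AE y in ?M. False" by simp
      then have "emeasure ?M (space ?M) = 0"
        by (simp add: eventually_False ae_filter_eq_bot_iff)
      then show False
        using S(2) by (simp add: emeasure_restrict_space space_M emeasure_lborel_sample_space(2)[OF S(1)])
    qed
    moreover have "0 \<le> ?D l" by (simp add: D_eq)
    ultimately show ?thesis by simp
  qed
  have Q_eq: "deformed_distribution \<alpha> S p l = density ?M (\<lambda>y. ennreal (exp (?L l y) / ?D l))" for l
    by (simp add: deformed_distribution_def deformed_density_def)

  show ?thesis
    unfolding generalized_complete_def
  proof (intro allI impI ballI)
    fix \<phi> :: "real ^ 'd \<Rightarrow> real" and l
    let ?\<phi>T = "\<lambda>y :: real ^ 'n. \<phi> (mean_statistic f y)"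
    assume hyp: "\<forall>l\<in>\<Lambda>. integrable (deformed_distribution \<alpha> S p l) ?\<phi>T \<and>
       (\<integral>y. ?\<phi>T y \<partial>deformed_distribution \<alpha> S p l) = 0"
      and l: "l \<in> \<Lambda>"
    \<comment> \<open>A measure with a density has the same measurable sets, so the integrability
      hypothesis supplies measurability over Lebesgue measure too.\<close>
    have \<phi>_meas: "?\<phi>T \<in> borel_measurable ?M"
      using hyp l borel_measurable_integrable[of _ ?\<phi>T] by (auto simp: Q_eq)
    have dens_meas: "(\<lambda>y. exp (?L l y) / ?D l) \<in> borel_measurable ?M" if "l \<in> \<Lambda>" for l
      using L_meas[OF that] by measurable
    have int: "integrable ?M (\<lambda>y. exp (?L l y) * ?\<phi>T y)"
      and zero: "(\<integral>y. exp (?L l y) * ?\<phi>T y \<partial>?M) = 0" if "l \<in> \<Lambda>" for l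
    proof -
      have "integrable ?M (\<lambda>y. exp (?L l y) / ?D l * ?\<phi>T y)"
        using hyp that D_pos[OF that] integrable_density[OF \<phi>_meas dens_meas[OF that]]
        by (simp add: Q_eq)
      from integrable_mult_right[OF this, of "?D l"]
      show "integrable ?M (\<lambda>y. exp (?L l y) * ?\<phi>T y)"
        using D_pos[OF that] by simp
      have "(\<integral>y. exp (?L l y) / ?D l * ?\<phi>T y \<partial>?M) = 0"
        using hyp that D_pos[OF that] integral_density[OF \<phi>_meas dens_meas[OF that]]
        by (simp add: Q_eq)
      then show "(\<integral>y. exp (?L l y) * ?\<phi>T y \<partial>?M) = 0"
        using D_pos[OF that] by (simp add: integral_divide_zero)
    qed
    let ?F = "\<lambda>y. exp (?L (param 0) y) * ?\<phi>T y"
    have tilt: "?F y * exp (\<theta> \<bullet> T y) = exp (K (param 0) - K (param \<theta>)) * (exp (?L (param \<theta>) y) * ?\<phi>T y)"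
      if "\<And>i. \<bar>\<theta> $ i\<bar> \<le> \<delta>" "y \<in> ?A" for \<theta> y
    proof -
      have "?L (param 0) y + \<theta> \<bullet> T y = K (param 0) - K (param \<theta>) + ?L (param \<theta>) y"
        using L_diff[OF param(1) that(2), of \<theta>] param(2)[of \<theta>] that(1) by simp
      then have "exp (?L (param 0) y) * exp (\<theta> \<bullet> T y) = exp (K (param 0) - K (param \<theta>)) * exp (?L (param \<theta>) y)"
        by (simp flip: exp_add)
      then show ?thesis by (simp add: mult_ac)
    qed
    have "AE y in ?M. ?F y = 0"
    proof (rule AE_zero_of_integral_vimage_zero[OF A _ T_meas])
      show "sets ?M = sets (restrict_space borel ?A)"
        by (rule sets_restrict_space_cong) simp
      show "integrable ?M ?F" by (rule int[OF param0(1)])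
      \<comment> \<open>As \<open>c\<close> is nonzero, equal values of \<open>T\<close> mean equal
        mean statistics, so the product is a positive factor times a square of a value of
        \<phi>.\<close>
      show "0 \<le> ?F x * ?F y" if "T x = T y" for x y
        using that \<open>c \<noteq> 0\<close> by (auto simp: T_def zero_le_mult_iff mult_le_0_iff)
      show "(\<integral>y. ?F y * indicator C (T y) \<partial>?M) = 0" if "C \<in> sets borel" for C
      proof (rule integral_vimage_zero_of_laplace_zero[OF T_meas \<open>0 < \<delta>\<close> _ _ that])
        fix \<theta> :: "real ^ 'd" assume \<theta>: "\<And>i. \<bar>\<theta> $ i\<bar> \<le> \<delta>"
        have cong: "integrable ?M (\<lambda>y. ?F y * exp (\<theta> \<bullet> T y))
            \<longleftrightarrow> integrable ?M (\<lambda>y. exp (K (param 0) - K (param \<theta>)) * (exp (?L (param \<theta>) y) * ?\<phi>T y))"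
          "(\<integral>y. ?F y * exp (\<theta> \<bullet> T y) \<partial>?M)
            = (\<integral>y. exp (K (param 0) - K (param \<theta>)) * (exp (?L (param \<theta>) y) * ?\<phi>T y) \<partial>?M)"
          by (intro Bochner_Integration.integrable_cong Bochner_Integration.integral_cong refl tilt \<theta>;
              simp add: space_M)+
        show "integrable ?M (\<lambda>y. ?F y * exp (\<theta> \<bullet> T y))"
          unfolding cong using int[OF param(1)[OF \<theta>]] by (intro integrable_mult_right)
        show "(\<integral>y. ?F y * exp (\<theta> \<bullet> T y) \<partial>?M) = 0"
          unfolding cong using zero[OF param(1)[OF \<theta>]] by simp
      qed
    qed
    let ?Q = "deformed_distribution \<alpha> S p l :: (real ^ 'n) measure"
    \<comment> \<open>The exponential factor never vanishes. The null set obtained is one for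
      Lebesgue measure, hence for the deformed distribution at every parameter.\<close>
    from \<open>AE y in ?M. ?F y = 0\<close> have "AE y in ?M. ?\<phi>T y = 0" by simp
    then have "AE y in ?Q. ?\<phi>T y = 0"
      unfolding Q_eq using dens_meas[OF l] by (subst AE_density) auto
    moreover have "prob_space ?Q"
    proof (rule prob_spaceI)
      have "emeasure ?Q (space ?Q) = (\<integral>\<^sup>+y. ennreal (exp (?L l y) / ?D l) \<partial>?M)"
        unfolding Q_eq space_density
        using dens_meas[OF l] sets.top[of ?M]
        by (subst emeasure_density) (auto intro!: nn_integral_cong)
      also have "\<dots> = ennreal (\<integral>y. exp (?L l y) / ?D l \<partial>?M)"
        using exp_L[OF l] D_pos[OF l] by (intro nn_integral_eq_integral) auto
      also have "\<dots> = 1"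
        using D_pos[OF l] D_eq[of l] by simp
      finally show "emeasure ?Q (space ?Q) = 1" .
    qed
    moreover have "{y \<in> space ?Q. ?\<phi>T y = 0} \<in> sets ?Q"
      using measurable_sets[OF \<phi>_meas, of "{0}"]
      by (simp add: Q_eq vimage_def Int_def conj_commute)
    ultimately show "measure ?Q {y \<in> space ?Q. ?\<phi>T y = 0} = 1"
      by (subst prob_space.prob_Collect_eq_1)
  qed
qed

end
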